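(* In the two-Principal linear-quadratic model described in the context, the following hold. (1) For $\Sigma=I_2$, the non-risky part of the remuneration of the Agent is higher in the aggregated model than in the competitive model: $\delta_a\ge\delta$, where $$\delta:=\tfrac{R_A}{2}\|\Sigma^\top M\Gamma\|^2+\tfrac12\|KM\Gamma\|^2,\qquad \delta_a:=\tfrac{R_A}{2}\|\Sigma^\top M_a\Gamma\|^2+\tfrac12\|KM_a\Gamma\|^2.$$ (2) Let $\Sigma=\begin{pmatrix}1&0\\ \rho&\sqrt{1-\rho^2}\end{pmatrix}$ and $k_1=k_2=k$. If $\gamma_1>\gamma_2$ then $\nu^{1,\star}>\nu^{2,\star}$, i.e. the Agent works more for the more ambitious Principal. (3) In the situation of (2), with $\gamma_1>\gamma_2$, the difference between the proportion of effort given by the Agent to the more ambitious Principal and that given to the less ambitious one, $$d(\rho):=\frac{\nu^{1,\star}(\rho)-\nu^{2,\star}(\rho)}{\nu^{1,\star}(\rho)+\nu^{2,\star}(\rho)},\qquad \rho\in[-1,1),$$ is an increasing and convex function of the correlation parameter $\rho$.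
   Context: $R_A>0$ is the Agent's risk aversion, $K=\mathrm{diag}(k_1,k_2)$ with efficiency parameters $k_1,k_2>0$, $\gamma_1,\gamma_2\in[0,1]$ are the appetence (ambition) parameters of Principals 1 and 2, and $\Gamma=(1+\gamma_1-\gamma_2,\,1+\gamma_2-\gamma_1)^\top$. The output has dynamics $dX_t=K\nu_tdt+\Sigma dW_t$ with $\Sigma\in\mathbb R^{2\times2}$, the Agent's cost of effort is $\|\nu\|^2/2$, and Principal $i$ has payoff $(1+\gamma_i)X^i_T-\gamma_iX^j_T-\xi^i$, $j\neq i$. Competitive model (two Principals in Nash equilibrium): the Agent's optimal effort is $\nu^\star=(\nu^{1,\star},\nu^{2,\star})^\top=KM\Gamma$ with $M=(I_2+2K^{-2}R_A\Sigma\Sigma^\top)^{-1}$, and his total salary is $R_0+T\delta+\int_0^TM\Gamma\cdot\Sigma dW^\star_s$. Aggregated model (one parent firm with payoff $X_T\cdot\Gamma-\xi$): the Agent's optimal effort is $KM_a\Gamma$ with $M_a=(R_A\Sigma\Sigma^\top+K^2)^{-1}K^2$, and his salary is $R_0+T\delta_a+\int_0^TM_a\Gamma\cdot\Sigma dW^\star_s$. Here $W^\star$ is a Brownian motion under the measure induced by the optimal effort, and $R_0$ is a constant. $\nu^\star(\rho)$ denotes the competitive effort as a function of the correlation parameter $\rho$ entering $\Sigma$. *)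

theory Defs
  imports "HOL-Analysis.Analysis"
begin

text \<open>
  Products and inverses of \<open>2 \<times> 2\<close> matrices are \<open>**\<close> and \<open>matrix_inv\<close>; the overloaded
  \<open>*\<close> on vectors acts componentwise, so \<open>K\<^sup>2\<close> is written \<open>K ** K\<close>.
  For positive \<open>R_A\<close>, \<open>k1\<close>, \<open>k2\<close> all matrices inverted below are invertible.
\<close>

definition efficiency_mat :: "real \<Rightarrow> real \<Rightarrow> real^2^2" where
  "efficiency_mat k1 k2 = vector [vector [k1, 0], vector [0, k2]]"

text \<open>The effective appetence of the two Principals: the coefficient of \<open>X\<^sup>i\<close> in the sum of
  the payoffs \<open>(1 + \<gamma>\<^sub>i) X\<^sup>i - \<gamma>\<^sub>i X\<^sup>j - \<xi>\<^sup>i\<close>.\<close>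

definition ambition_vec :: "real \<Rightarrow> real \<Rightarrow> real^2" where
  "ambition_vec g1 g2 = vector [1 + g1 - g2, 1 + g2 - g1]"

definition corr_vol :: "real \<Rightarrow> real^2^2" where
  "corr_vol \<rho> = vector [vector [1, 0], vector [\<rho>, sqrt (1 - \<rho>\<^sup>2)]]"

text \<open>\<open>M = (I + 2 K\<^sup>-\<^sup>2 R_A \<Sigma> \<Sigma>\<^sup>T)\<^sup>-\<^sup>1\<close>, for two Principals in Nash equilibrium.\<close>

definition competitive_mat :: "real \<Rightarrow> real^2^2 \<Rightarrow> real^2^2 \<Rightarrow> real^2^2" where
  "competitive_mat R_A K S =
     matrix_inv (mat 1 + (2 * R_A) *\<^sub>R (matrix_inv (K ** K) ** (S ** transpose S)))"

text \<open>\<open>M\<^sub>a = (R_A \<Sigma> \<Sigma>\<^sup>T + K\<^sup>2)\<^sup>-\<^sup>1 K\<^sup>2\<close>, for a single parent firm.\<close>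

definition aggregated_mat :: "real \<Rightarrow> real^2^2 \<Rightarrow> real^2^2 \<Rightarrow> real^2^2" where
  "aggregated_mat R_A K S = matrix_inv (R_A *\<^sub>R (S ** transpose S) + K ** K) ** (K ** K)"

text \<open>In either model, with \<open>N\<close> the corresponding matrix and \<open>G\<close> the ambition vector, the
  salary is \<open>R\<^sub>0 + T \<delta> + \<integral> N G \<cdot> \<Sigma> dW\<close> and the optimal effort is the constant \<open>K N G\<close>.
  The rate \<open>\<delta>\<close> compensates the Agent for the risk borne and for the cost of effort.\<close>

definition optimal_effort :: "real^2^2 \<Rightarrow> real^2^2 \<Rightarrow> real^2 \<Rightarrow> real^2" where
  "optimal_effort K N G = K *v (N *v G)"

definition nonrisky_rate :: "real \<Rightarrow> real^2^2 \<Rightarrow> real^2^2 \<Rightarrow> real^2^2 \<Rightarrow> real^2 \<Rightarrow> real" where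
  "nonrisky_rate R_A K S N G =
     R_A / 2 * (norm (transpose S *v (N *v G)))\<^sup>2 + 1 / 2 * (norm (optimal_effort K N G))\<^sup>2"

definition competitive_effort :: "real \<Rightarrow> real^2^2 \<Rightarrow> real^2^2 \<Rightarrow> real^2 \<Rightarrow> real^2" where
  "competitive_effort R_A K S G = optimal_effort K (competitive_mat R_A K S) G"

definition competitive_rate :: "real \<Rightarrow> real^2^2 \<Rightarrow> real^2^2 \<Rightarrow> real^2 \<Rightarrow> real" where
  "competitive_rate R_A K S G = nonrisky_rate R_A K S (competitive_mat R_A K S) G"

definition aggregated_rate :: "real \<Rightarrow> real^2^2 \<Rightarrow> real^2^2 \<Rightarrow> real^2 \<Rightarrow> real" where
  "aggregated_rate R_A K S G = nonrisky_rate R_A K S (aggregated_mat R_A K S) G"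

definition effort_gap :: "real^2 \<Rightarrow> real" where
  "effort_gap v = (v $ 1 - v $ 2) / (v $ 1 + v $ 2)"

end

theory Submission
  imports Defs
begin

text \<open>
  Every effort and salary here is governed by one family of linear systems. Multiplying
  \<open>(I + 2 K\<^sup>-\<^sup>2 R \<Sigma> \<Sigma>\<^sup>T) x = \<Gamma>\<close> by \<open>K\<^sup>2\<close> gives \<open>(2 R \<Sigma> \<Sigma>\<^sup>T + K\<^sup>2) x = K\<^sup>2 \<Gamma>\<close>, which is the system
  of the aggregated model for the risk aversion \<open>2 R\<close>. So competition acts on the sensitivity of
  the salary exactly as a doubling of the risk aversion of the Agent
  (\<open>competitive_mat_eq_aggregated_mat\<close>), and it suffices to study the sensitivity of an aggregated
  model whose risk aversion \<open>r\<close> is free.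

  With independent outputs the system is diagonal, and the sensitivities
  \<open>k\<^sub>i\<^sup>2 \<Gamma>\<^sub>i / (r + k\<^sub>i\<^sup>2)\<close> shrink in absolute value as \<open>r\<close> grows. The non-risky rate is a sum of
  squares of them with positive weights that do not depend on \<open>r\<close>, so it is lower at \<open>r = 2 R\<close>
  than at \<open>r = R\<close>.

  With equal efficiencies the system matrix commutes with the exchange of the two Principals, so
  it is diagonal in the sum and the difference of the coordinates, with eigenvalues
  \<open>r (1 + \<rho>) + k\<^sup>2\<close> and \<open>r (1 - \<rho>) + k\<^sup>2\<close>. As \<open>\<Gamma>\<^sub>1 + \<Gamma>\<^sub>2 = 2\<close> and \<open>\<Gamma>\<^sub>1 - \<Gamma>\<^sub>2 = 2 (\<gamma>\<^sub>1 - \<gamma>\<^sub>2)\<close>, both sum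
  and difference of the efforts are positive when \<open>\<gamma>\<^sub>1 > \<gamma>\<^sub>2\<close>, and their quotient is
  \<open>\<gamma>\<^sub>1 - \<gamma>\<^sub>2\<close> times the ratio of the two eigenvalues. That ratio is
  \<open>2 (r + k\<^sup>2) / (r (1 - \<rho>) + k\<^sup>2) - 1\<close>: the reciprocal of a positive, decreasing, affine function
  of \<open>\<rho>\<close>, up to a positive factor and a constant, hence increasing and convex.
\<close>

lemma matrix_inv_unique:
  fixes A B :: "real^'n^'n"
  assumes "A ** B = mat 1"
  shows "matrix_inv A = B"
proof -
  have "B ** A = mat 1"
    using assms matrix_left_right_inverse by blast
  with assms have "\<exists>C. A ** C = mat 1 \<and> C ** A = mat 1"
    by blast
  then have "matrix_inv A ** A = mat 1"
    unfolding matrix_inv_def by (rule someI2_ex) blast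
  then have "matrix_inv A ** (A ** B) = B"
    by (simp add: matrix_mul_assoc)
  with assms show ?thesis
    by simp
qed

lemma matrix_inv_inverse:
  fixes A :: "real^'n^'n"
  assumes "invertible A"
  shows "A ** matrix_inv A = mat 1" "matrix_inv A ** A = mat 1"
  using assms matrix_inv_unique unfolding invertible_def by metis+

section \<open>Competition as a doubled risk aversion\<close>

text \<open>The inverse of \<open>K\<^sup>-\<^sup>2 (2 R \<Sigma> \<Sigma>\<^sup>T + K\<^sup>2)\<close> reverses the order of the factors.\<close>

lemma competitive_mat_eq_aggregated_mat:
  assumes K: "invertible (K ** K)"
    and B: "invertible ((2 * R) *\<^sub>R (S ** transpose S) + K ** K)"
  shows "competitive_mat R K S = aggregated_mat (2 * R) K S"
proof -
  let ?L = "matrix_inv (K ** K)"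
  let ?B = "(2 * R) *\<^sub>R (S ** transpose S) + K ** K"
  have "mat 1 + (2 * R) *\<^sub>R (?L ** (S ** transpose S)) = ?L ** ?B"
    using matrix_inv_inverse(2)[OF K]
    by (simp add: matrix_add_ldistrib matrix_scalar_ac add.commute
        flip: scalar_matrix_assoc)
  moreover have "(?L ** ?B) ** (matrix_inv ?B ** (K ** K)) = ?L ** (?B ** matrix_inv ?B) ** (K ** K)"
    by (simp only: matrix_mul_assoc)
  then have "(?L ** ?B) ** (matrix_inv ?B ** (K ** K)) = mat 1"
    using matrix_inv_inverse(1)[OF B] matrix_inv_inverse(2)[OF K] by simp
  ultimately show ?thesis
    unfolding competitive_mat_def aggregated_mat_def by (simp add: matrix_inv_unique)
qed

section \<open>The linear system for the sensitivities\<close>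

lemma efficiency_mat_squared:
  "efficiency_mat k1 k2 ** efficiency_mat k1 k2 = vector [vector [k1\<^sup>2, 0], vector [0, k2\<^sup>2]]"
  by (simp add: efficiency_mat_def vec_eq_iff forall_2 matrix_matrix_mult_def sum_2
      power2_eq_square)

lemma corr_vol_covariance:
  assumes "\<rho> \<in> {-1..1}"
  shows "corr_vol \<rho> ** transpose (corr_vol \<rho>) = vector [vector [1, \<rho>], vector [\<rho>, 1]]"
proof -
  have "\<rho>\<^sup>2 \<le> 1"
    using assms by (simp add: abs_square_le_1 abs_le_iff)
  then show ?thesis
    by (simp add: corr_vol_def vec_eq_iff forall_2 matrix_matrix_mult_def sum_2 transpose_def
        flip: power2_eq_square)
qed

lemma corr_vol_zero: "corr_vol 0 = mat 1"
  by (simp add: corr_vol_def vec_eq_iff forall_2 mat_def)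

lemma system_mat_eq:
  assumes "\<rho> \<in> {-1..1}"
  shows "r *\<^sub>R (corr_vol \<rho> ** transpose (corr_vol \<rho>)) + efficiency_mat k1 k2 ** efficiency_mat k1 k2
    = vector [vector [r + k1\<^sup>2, r * \<rho>], vector [r * \<rho>, r + k2\<^sup>2]]"
  by (simp add: corr_vol_covariance[OF assms] efficiency_mat_squared vec_eq_iff forall_2)

text \<open>The volatility is singular at \<open>\<rho> = \<plusminus>1\<close>; the positive term \<open>K\<^sup>2\<close> keeps the system regular
  there.\<close>

lemma system_mat_invertible:
  assumes "r \<ge> 0" "k1 > 0" "k2 > 0" and \<rho>: "\<rho> \<in> {-1..1}"
  shows "invertible (r *\<^sub>R (corr_vol \<rho> ** transpose (corr_vol \<rho>))
    + efficiency_mat k1 k2 ** efficiency_mat k1 k2)"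
proof -
  have "\<rho>\<^sup>2 \<le> 1"
    using \<rho> by (simp add: abs_square_le_1 abs_le_iff)
  then have "(r * \<rho>)\<^sup>2 \<le> r * r"
    using mult_left_mono[of "\<rho>\<^sup>2" 1 "r\<^sup>2"] by (simp add: power_mult_distrib flip: power2_eq_square)
  also have "\<dots> < (r + k1\<^sup>2) * (r + k2\<^sup>2)"
    using assms by (intro mult_strict_mono') auto
  finally show ?thesis
    unfolding system_mat_eq[OF \<rho>] invertible_det_nz det_2 by (simp add: power2_eq_square)
qed

lemma aggregated_sensitivity_system:
  fixes G :: "real^2"
  assumes "r \<ge> 0" "k1 > 0" "k2 > 0" and \<rho>: "\<rho> \<in> {-1..1}"
  defines "x \<equiv> aggregated_mat r (efficiency_mat k1 k2) (corr_vol \<rho>) *v G"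
  shows "(r + k1\<^sup>2) * x $ 1 + r * \<rho> * x $ 2 = k1\<^sup>2 * G $ 1"
    and "r * \<rho> * x $ 1 + (r + k2\<^sup>2) * x $ 2 = k2\<^sup>2 * G $ 2"
proof -
  let ?K2 = "efficiency_mat k1 k2 ** efficiency_mat k1 k2"
  let ?B = "r *\<^sub>R (corr_vol \<rho> ** transpose (corr_vol \<rho>)) + ?K2"
  have "?B ** matrix_inv ?B = mat 1"
    using system_mat_invertible[OF assms(1-4)] by (rule matrix_inv_inverse(1))
  then have "?B ** aggregated_mat r (efficiency_mat k1 k2) (corr_vol \<rho>) = ?K2"
    unfolding aggregated_mat_def by (simp add: matrix_mul_assoc)
  then have "?B *v x = ?K2 *v G"
    unfolding x_def by (simp add: matrix_vector_mul_assoc)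
  then have "(vector [vector [r + k1\<^sup>2, r * \<rho>], vector [r * \<rho>, r + k2\<^sup>2]] :: real^2^2) *v x
      = (vector [vector [k1\<^sup>2, 0], vector [0, k2\<^sup>2]] :: real^2^2) *v G"
    unfolding system_mat_eq[OF \<rho>] unfolding efficiency_mat_squared .
  then show "(r + k1\<^sup>2) * x $ 1 + r * \<rho> * x $ 2 = k1\<^sup>2 * G $ 1"
    and "r * \<rho> * x $ 1 + (r + k2\<^sup>2) * x $ 2 = k2\<^sup>2 * G $ 2"
    by (simp_all add: vec_eq_iff forall_2 matrix_vector_mult_def sum_2)
qed

lemma competitive_mat_corr_vol:
  assumes "R \<ge> 0" "k1 > 0" "k2 > 0" "\<rho> \<in> {-1..1}"
  shows "competitive_mat R (efficiency_mat k1 k2) (corr_vol \<rho>)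
    = aggregated_mat (2 * R) (efficiency_mat k1 k2) (corr_vol \<rho>)"
proof (rule competitive_mat_eq_aggregated_mat)
  show "invertible (efficiency_mat k1 k2 ** efficiency_mat k1 k2)"
    using system_mat_invertible[of 0 k1 k2 \<rho>] assms by simp
  show "invertible ((2 * R) *\<^sub>R (corr_vol \<rho> ** transpose (corr_vol \<rho>))
      + efficiency_mat k1 k2 ** efficiency_mat k1 k2)"
    using assms by (intro system_mat_invertible) auto
qed

lemma optimal_effort_component:
  "optimal_effort (efficiency_mat k1 k2) N G $ 1 = k1 * (N *v G) $ 1"
  "optimal_effort (efficiency_mat k1 k2) N G $ 2 = k2 * (N *v G) $ 2"
  by (simp_all add: optimal_effort_def efficiency_mat_def matrix_vector_mult_def[of "vector _"]
      sum_2)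

section \<open>The non-risky rate for independent outputs\<close>

lemma nonrisky_rate_independent:
  "nonrisky_rate R (efficiency_mat k1 k2) (mat 1) N G
    = (R + k1\<^sup>2) / 2 * ((N *v G) $ 1)\<^sup>2 + (R + k2\<^sup>2) / 2 * ((N *v G) $ 2)\<^sup>2"
  unfolding nonrisky_rate_def power2_norm_eq_inner
  by (simp add: inner_vec_def sum_2 optimal_effort_component transpose_mat power2_eq_square
      field_simps)

lemma aggregated_sensitivity_independent:
  assumes "r \<ge> 0" "k1 > 0" "k2 > 0"
  shows "(aggregated_mat r (efficiency_mat k1 k2) (mat 1) *v G) $ 1 = k1\<^sup>2 * G $ 1 / (r + k1\<^sup>2)"
    and "(aggregated_mat r (efficiency_mat k1 k2) (mat 1) *v G) $ 2 = k2\<^sup>2 * G $ 2 / (r + k2\<^sup>2)"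
proof -
  have "r + k1\<^sup>2 > 0" "r + k2\<^sup>2 > 0"
    using assms by (auto intro: add_nonneg_pos)
  then show "(aggregated_mat r (efficiency_mat k1 k2) (mat 1) *v G) $ 1 = k1\<^sup>2 * G $ 1 / (r + k1\<^sup>2)"
    and "(aggregated_mat r (efficiency_mat k1 k2) (mat 1) *v G) $ 2 = k2\<^sup>2 * G $ 2 / (r + k2\<^sup>2)"
    using aggregated_sensitivity_system[OF assms, of 0 G]
    by (simp_all add: corr_vol_zero eq_divide_eq mult.commute)
qed

text \<open>A more risk-averse Agent is exposed less to each output.\<close>

lemma squared_sensitivity_antimono:
  fixes k g r s :: real
  assumes "0 \<le> r" "r \<le> s" "k > 0"
  shows "(k\<^sup>2 * g / (s + k\<^sup>2))\<^sup>2 \<le> (k\<^sup>2 * g / (r + k\<^sup>2))\<^sup>2"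
  unfolding power_divide
  using assms by (intro divide_left_mono power_mono mult_pos_pos zero_less_power)
    (auto intro: add_nonneg_pos)

lemma competitive_rate_le_aggregated_rate:
  assumes "R > 0" "k1 > 0" "k2 > 0"
  shows "competitive_rate R (efficiency_mat k1 k2) (mat 1) G
    \<le> aggregated_rate R (efficiency_mat k1 k2) (mat 1) G"
proof -
  have "competitive_mat R (efficiency_mat k1 k2) (mat 1)
      = aggregated_mat (2 * R) (efficiency_mat k1 k2) (mat 1)"
    using competitive_mat_corr_vol[of R k1 k2 0] assms by (simp add: corr_vol_zero)
  then show ?thesis
    using assms
    by (auto simp: competitive_rate_def aggregated_rate_def nonrisky_rate_independent
        aggregated_sensitivity_independent
        intro!: add_mono mult_left_mono squared_sensitivity_antimono)
qed

section \<open>The efforts for equally efficient tasks\<close>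

text \<open>The sum and the difference of the efforts are their inner products with the eigenvectors
  \<open>(1, 1)\<close> and \<open>(1, -1)\<close> of the symmetric system matrix, so the system decouples in them. The cube
  of \<open>k\<close> is \<open>K\<^sup>2\<close> from the right-hand side of the system times \<open>K\<close> from the effort \<open>K x\<close>.\<close>

lemma competitive_effort_sum_diff:
  fixes R k g1 g2 :: real
  assumes "R > 0" "k > 0" and \<rho>: "\<rho> \<in> {-1..1}"
  defines "v \<equiv> competitive_effort R (efficiency_mat k k) (corr_vol \<rho>) (ambition_vec g1 g2)"
  shows "v $ 1 + v $ 2 = 2 * k ^ 3 / (2 * R * (1 + \<rho>) + k\<^sup>2)"
    and "v $ 1 - v $ 2 = 2 * k ^ 3 * (g1 - g2) / (2 * R * (1 - \<rho>) + k\<^sup>2)"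
proof -
  define x where
    "x = aggregated_mat (2 * R) (efficiency_mat k k) (corr_vol \<rho>) *v ambition_vec g1 g2"
  have v: "v $ 1 = k * x $ 1" "v $ 2 = k * x $ 2"
    using assms
    by (simp_all add: v_def x_def competitive_effort_def optimal_effort_component
        competitive_mat_corr_vol)
  have eq1: "(2 * R + k\<^sup>2) * x $ 1 + 2 * R * \<rho> * x $ 2 = k\<^sup>2 * (1 + g1 - g2)"
    and eq2: "2 * R * \<rho> * x $ 1 + (2 * R + k\<^sup>2) * x $ 2 = k\<^sup>2 * (1 + g2 - g1)"
    using aggregated_sensitivity_system[of "2 * R" k k \<rho> "ambition_vec g1 g2"] assms
    by (simp_all add: x_def ambition_vec_def)
  have pos: "2 * R * (1 + \<rho>) + k\<^sup>2 > 0" "2 * R * (1 - \<rho>) + k\<^sup>2 > 0"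
    using assms by (auto intro!: add_nonneg_pos)
  have "(2 * R * (1 + \<rho>) + k\<^sup>2) * (x $ 1 + x $ 2) = 2 * k\<^sup>2"
    using eq1 eq2 by algebra
  then have "(v $ 1 + v $ 2) * (2 * R * (1 + \<rho>) + k\<^sup>2) = 2 * k ^ 3"
    unfolding v by algebra
  then show "v $ 1 + v $ 2 = 2 * k ^ 3 / (2 * R * (1 + \<rho>) + k\<^sup>2)"
    using pos by (simp add: eq_divide_eq)
  have "(2 * R * (1 - \<rho>) + k\<^sup>2) * (x $ 1 - x $ 2) = 2 * k\<^sup>2 * (g1 - g2)"
    using eq1 eq2 by algebra
  then have "(v $ 1 - v $ 2) * (2 * R * (1 - \<rho>) + k\<^sup>2) = 2 * k ^ 3 * (g1 - g2)"
    unfolding v by algebra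
  then show "v $ 1 - v $ 2 = 2 * k ^ 3 * (g1 - g2) / (2 * R * (1 - \<rho>) + k\<^sup>2)"
    using pos by (simp add: eq_divide_eq)
qed

lemma competitive_effort_more_ambitious:
  assumes "R > 0" "k > 0" "g1 > g2" "\<rho> \<in> {-1..1}"
  shows "competitive_effort R (efficiency_mat k k) (corr_vol \<rho>) (ambition_vec g1 g2) $ 2
    < competitive_effort R (efficiency_mat k k) (corr_vol \<rho>) (ambition_vec g1 g2) $ 1"
proof -
  have "2 * R * (1 - \<rho>) + k\<^sup>2 > 0"
    using assms by (auto intro!: add_nonneg_pos)
  then have "2 * k ^ 3 * (g1 - g2) / (2 * R * (1 - \<rho>) + k\<^sup>2) > 0"
    using assms by simp
  then show ?thesis
    using competitive_effort_sum_diff(2)[of R k \<rho> g1 g2] assms by linarith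
qed

lemma effort_gap_competitive_effort:
  assumes "R > 0" "k > 0" "\<rho> \<in> {-1..1}"
  shows "effort_gap (competitive_effort R (efficiency_mat k k) (corr_vol \<rho>) (ambition_vec g1 g2))
    = (g1 - g2) * (2 * (2 * R + k\<^sup>2) * inverse (2 * R * (1 - \<rho>) + k\<^sup>2) - 1)"
proof -
  have "2 * R * (1 + \<rho>) + k\<^sup>2 > 0" "2 * R * (1 - \<rho>) + k\<^sup>2 > 0"
    using assms by (auto intro!: add_nonneg_pos)
  then show ?thesis
    unfolding effort_gap_def competitive_effort_sum_diff[OF assms]
    using assms by (simp add: divide_simps) (simp add: algebra_simps)
qed

section \<open>Monotonicity and convexity of the effort gap\<close>

text \<open>For \<open>\<gamma>\<^sub>1 > \<gamma>\<^sub>2\<close> the effort gap is a positive multiple, plus a constant, of the reciprocal of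
  the eigenvalue for \<open>(1, -1)\<close>.\<close>

lemma inverse_system_eigenvalue_strict_mono:
  fixes r k :: real
  assumes "r > 0" "k > 0"
  shows "strict_mono_on {-1..<1} (\<lambda>\<rho>. inverse (r * (1 - \<rho>) + k\<^sup>2))"
  using assms by (auto intro!: strict_mono_onI less_imp_inverse_less add_nonneg_pos)

lemma inverse_system_eigenvalue_convex:
  fixes r k :: real
  assumes "r > 0" "k > 0"
  shows "convex_on {-1..<1} (\<lambda>\<rho>. inverse (r * (1 - \<rho>) + k\<^sup>2))"
proof (rule convex_onI)
  fix t x y :: real
  assume t: "0 < t" "t < 1" and xy: "x \<in> {-1..<1}" "y \<in> {-1..<1}"
  let ?q = "\<lambda>\<rho>. r * (1 - \<rho>) + k\<^sup>2"
  have "?q x \<in> {0<..}" "?q y \<in> {0<..}"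
    using assms xy by (auto intro!: add_nonneg_pos)
  then have "inverse ((1 - t) *\<^sub>R ?q x + t *\<^sub>R ?q y) \<le> (1 - t) * inverse (?q x) + t * inverse (?q y)"
    using convex_onD[OF convex_on_inverse[of "{0<..}"], of t "?q x" "?q y"] t by simp
  moreover have "(1 - t) *\<^sub>R ?q x + t *\<^sub>R ?q y = ?q ((1 - t) *\<^sub>R x + t *\<^sub>R y)"
    by (simp add: algebra_simps)
  ultimately show "inverse (?q ((1 - t) *\<^sub>R x + t *\<^sub>R y))
      \<le> (1 - t) * inverse (?q x) + t * inverse (?q y)"
    by simp
qed simp

lemma convex_on_cong_on:
  assumes "convex_on S f" "\<And>x. x \<in> S \<Longrightarrow> g x = f x"
  shows "convex_on S g"
  using assms unfolding convex_on_def convex_def by auto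

lemma effort_gap_strict_mono:
  assumes "R > 0" "k > 0" "g1 > g2"
  shows "strict_mono_on {-1..<1} (\<lambda>\<rho>. effort_gap
    (competitive_effort R (efficiency_mat k k) (corr_vol \<rho>) (ambition_vec g1 g2)))"
proof (rule strict_mono_onI)
  fix x y :: real
  assume xy: "x \<in> {-1..<1}" "y \<in> {-1..<1}" "x < y"
  have "inverse (2 * R * (1 - x) + k\<^sup>2) < inverse (2 * R * (1 - y) + k\<^sup>2)"
    using strict_mono_onD[OF inverse_system_eigenvalue_strict_mono[of "2 * R" k] xy] assms
    by simp
  then have "(g1 - g2) * (2 * (2 * R + k\<^sup>2) * inverse (2 * R * (1 - x) + k\<^sup>2) - 1)
      < (g1 - g2) * (2 * (2 * R + k\<^sup>2) * inverse (2 * R * (1 - y) + k\<^sup>2) - 1)"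
    using assms by (intro mult_strict_left_mono diff_strict_right_mono) (auto intro: add_pos_pos)
  then show "effort_gap
      (competitive_effort R (efficiency_mat k k) (corr_vol x) (ambition_vec g1 g2))
    < effort_gap (competitive_effort R (efficiency_mat k k) (corr_vol y) (ambition_vec g1 g2))"
    using assms xy by (simp add: effort_gap_competitive_effort)
qed

lemma effort_gap_convex:
  assumes "R > 0" "k > 0" "g1 > g2"
  shows "convex_on {-1..<1} (\<lambda>\<rho>. effort_gap
    (competitive_effort R (efficiency_mat k k) (corr_vol \<rho>) (ambition_vec g1 g2)))"
proof -
  have "convex_on {-1..<1} (\<lambda>\<rho>. (g1 - g2) *
      (2 * (2 * R + k\<^sup>2) * inverse (2 * R * (1 - \<rho>) + k\<^sup>2) + (- 1)))"
    using assms
    by (intro convex_on_cmul convex_on_add inverse_system_eigenvalue_convex)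
      (auto simp: convex_on_const)
  then show ?thesis
    using assms by (elim convex_on_cong_on) (simp add: effort_gap_competitive_effort)
qed

theorem proposition5p3:
  fixes R_A k1 k2 \<gamma>1 \<gamma>2 :: real
  assumes "R_A > 0" and "k1 > 0" and "k2 > 0"
    and "\<gamma>1 \<in> {0..1}" and "\<gamma>2 \<in> {0..1}"
  shows "aggregated_rate R_A (efficiency_mat k1 k2) (mat 1) (ambition_vec \<gamma>1 \<gamma>2)
           \<ge> competitive_rate R_A (efficiency_mat k1 k2) (mat 1) (ambition_vec \<gamma>1 \<gamma>2)
    \<and> (k1 = k2 \<and> \<gamma>1 > \<gamma>2 \<longrightarrow>
        (\<forall>\<rho>\<in>{-1..1}.
           competitive_effort R_A (efficiency_mat k1 k2) (corr_vol \<rho>) (ambition_vec \<gamma>1 \<gamma>2) $ 1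
             > competitive_effort R_A (efficiency_mat k1 k2) (corr_vol \<rho>) (ambition_vec \<gamma>1 \<gamma>2) $ 2))
    \<and> (k1 = k2 \<and> \<gamma>1 > \<gamma>2 \<longrightarrow>
        strict_mono_on {-1..<1} (\<lambda>\<rho>. effort_gap
          (competitive_effort R_A (efficiency_mat k1 k2) (corr_vol \<rho>) (ambition_vec \<gamma>1 \<gamma>2)))
        \<and> convex_on {-1..<1} (\<lambda>\<rho>. effort_gap
          (competitive_effort R_A (efficiency_mat k1 k2) (corr_vol \<rho>) (ambition_vec \<gamma>1 \<gamma>2))))"
  using assms competitive_rate_le_aggregated_rate competitive_effort_more_ambitious
    effort_gap_strict_mono effort_gap_convex
  by auto

end
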